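(* Let $(X,d_\theta)$ be a complete $\theta$-metric space (with respect to a $B$-action $\theta$), let $\zeta$ be a simulation function, and let $T:X\to X$ be a modified $\mathcal{Z}$-contraction with respect to $\zeta$. Then $T$ has a unique fixed point $u$ in $X$, and for every $x_0\in X$ the Picard sequence $\{x_n\}$, defined by $x_n=Tx_{n-1}$ for $n\ge1$, converges to the fixed point $u$ of $T$.
   Context: A simulation function is a map $\zeta:[0,\infty)\times[0,\infty)\to\mathbb{R}$ such that: ($\zeta1$) $\zeta(0,0)=0$; ($\zeta2$) $\zeta(t,s)<s-t$ for all $s,t>0$; ($\zeta3$) if $\{t_n\},\{s_n\}$ are sequences in $(0,\infty)$ with $\lim_{n\to\infty}t_n=\lim_{n\to\infty}s_n>0$, then $\limsup_{n\to\infty}\zeta(t_n,s_n)<0$. The set of all simulation functions is denoted $\mathcal{Z}$. A $B$-action is a map $\theta:[0,\infty)\times[0,\infty)\to[0,\infty)$, continuous with respect to both variables, with image $\mathrm{Im}(\theta)=\{\theta(s,t):s\ge0,\,t\ge0\}$, such that: (B1) $\theta(0,0)=0$ and $\theta(s,t)=\theta(t,s)$ for all $s,t\ge0$; (B2) $\theta(s,t)<\theta(u,v)$ whenever either $s<u$ and $t\le v$, or $s\le u$ and $t<v$; (B3) for each $r\in\mathrm{Im}(\theta)$ and each $s\in[0,r]$ there exists $t\in[0,r]$ with $\theta(t,s)=r$; (B4) $\theta(s,0)\le s$ for all $s>0$. Let $X$ be a non-empty set. A $\theta$-metric on $X$ with respect to a $B$-action $\theta$ is a map $d_\theta:X\times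 X\to[0,\infty)$ such that for all $x,y,z\in X$: ($\theta1$) $d_\theta(x,y)=0$ if and only if $x=y$; ($\theta2$) $d_\theta(x,y)=d_\theta(y,x)$; ($\theta3$) $d_\theta(x,y)\le\theta(d_\theta(x,z),d_\theta(z,y))$. The pair $(X,d_\theta)$ is then a $\theta$-metric space. A sequence $\{x_n\}$ in $X$ converges to $x\in X$ if $d_\theta(x_n,x)\to0$; it is Cauchy if $d_\theta(x_n,x_m)\to0$ as $n,m\to\infty$; $(X,d_\theta)$ is complete if every Cauchy sequence converges to a point of $X$. A self-map $T:X\to X$ is a modified $\mathcal{Z}$-contraction with respect to $\zeta\in\mathcal{Z}$ if $\zeta(d_\theta(Tx,Ty),M(x,y))\ge0$ for all $x,y\in X$, where $M(x,y)=\max\{d_\theta(x,y),d_\theta(x,Tx),d_\theta(y,Ty)\}$. A fixed point of $T$ is a point $x\in X$ with $Tx=x$. *)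

theory Defs
  imports Complex_Main "HOL-Library.Extended_Real" "HOL-Library.FuncSet"
begin

text \<open>
  Maps on \<open>[0,\<infinity>) \<times> [0,\<infinity>)\<close> are rendered as total curried functions on the reals; every
  condition is restricted to nonnegative arguments, so values elsewhere are irrelevant.
\<close>

(* The limit superior is taken in the extended reals, since the sequence of values of \<zeta>
   need not be bounded below; the value -\<infinity> counts as < 0. *)
definition simulation_function :: "(real \<Rightarrow> real \<Rightarrow> real) \<Rightarrow> bool" where
  "simulation_function \<zeta> \<longleftrightarrow>
     \<zeta> 0 0 = 0 \<and>
     (\<forall>t>0. \<forall>s>0. \<zeta> t s < s - t) \<and>
     (\<forall>(t :: nat \<Rightarrow> real) (s :: nat \<Rightarrow> real) l.
        (\<forall>n. t n > 0) \<and> (\<forall>n. s n > 0) \<and> t \<longlonglongrightarrow> l \<and> s \<longlonglongrightarrow> l \<and> l > 0 \<longrightarrow>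
        limsup (\<lambda>n. ereal (\<zeta> (t n) (s n))) < 0)"

definition action_image :: "(real \<Rightarrow> real \<Rightarrow> real) \<Rightarrow> real set" where
  "action_image \<theta> = {\<theta> s t | s t. s \<ge> 0 \<and> t \<ge> 0}"

(* Continuity is joint; for a map satisfying the strict monotonicity condition below, separate
   continuity in each variable is equivalent to it. *)
definition B_action :: "(real \<Rightarrow> real \<Rightarrow> real) \<Rightarrow> bool" where
  "B_action \<theta> \<longleftrightarrow>
     (\<forall>s\<ge>0. \<forall>t\<ge>0. \<theta> s t \<ge> 0) \<and>
     continuous_on ({0..} \<times> {0..}) (\<lambda>(s, t). \<theta> s t) \<and>
     \<theta> 0 0 = 0 \<and>
     (\<forall>s\<ge>0. \<forall>t\<ge>0. \<theta> s t = \<theta> t s) \<and>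
     (\<forall>s\<ge>0. \<forall>t\<ge>0. \<forall>u\<ge>0. \<forall>v\<ge>0.
        (s < u \<and> t \<le> v) \<or> (s \<le> u \<and> t < v) \<longrightarrow> \<theta> s t < \<theta> u v) \<and>
     (\<forall>r\<in>action_image \<theta>. \<forall>s\<in>{0..r}. \<exists>t\<in>{0..r}. \<theta> t s = r) \<and>
     (\<forall>s>0. \<theta> s 0 \<le> s)"

definition theta_metric_space ::
    "'a set \<Rightarrow> (real \<Rightarrow> real \<Rightarrow> real) \<Rightarrow> ('a \<Rightarrow> 'a \<Rightarrow> real) \<Rightarrow> bool" where
  "theta_metric_space X \<theta> d \<longleftrightarrow>
     X \<noteq> {} \<and> B_action \<theta> \<and>
     (\<forall>x\<in>X. \<forall>y\<in>X. d x y \<ge> 0) \<and>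
     (\<forall>x\<in>X. \<forall>y\<in>X. d x y = 0 \<longleftrightarrow> x = y) \<and>
     (\<forall>x\<in>X. \<forall>y\<in>X. d x y = d y x) \<and>
     (\<forall>x\<in>X. \<forall>y\<in>X. \<forall>z\<in>X. d x y \<le> \<theta> (d x z) (d z y))"

definition theta_converges :: "('a \<Rightarrow> 'a \<Rightarrow> real) \<Rightarrow> (nat \<Rightarrow> 'a) \<Rightarrow> 'a \<Rightarrow> bool" where
  "theta_converges d x a \<longleftrightarrow> (\<lambda>n. d (x n) a) \<longlonglongrightarrow> 0"

definition theta_Cauchy :: "('a \<Rightarrow> 'a \<Rightarrow> real) \<Rightarrow> (nat \<Rightarrow> 'a) \<Rightarrow> bool" where
  "theta_Cauchy d x \<longleftrightarrow> (\<forall>\<epsilon>>0. \<exists>N. \<forall>n\<ge>N. \<forall>m\<ge>N. d (x n) (x m) < \<epsilon>)"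

definition complete_theta_metric_space ::
    "'a set \<Rightarrow> (real \<Rightarrow> real \<Rightarrow> real) \<Rightarrow> ('a \<Rightarrow> 'a \<Rightarrow> real) \<Rightarrow> bool" where
  "complete_theta_metric_space X \<theta> d \<longleftrightarrow>
     theta_metric_space X \<theta> d \<and>
     (\<forall>x. (\<forall>n. x n \<in> X) \<and> theta_Cauchy d x \<longrightarrow> (\<exists>a\<in>X. theta_converges d x a))"

definition modified_Z_contraction ::
    "'a set \<Rightarrow> ('a \<Rightarrow> 'a \<Rightarrow> real) \<Rightarrow> (real \<Rightarrow> real \<Rightarrow> real) \<Rightarrow> ('a \<Rightarrow> 'a) \<Rightarrow> bool" where
  "modified_Z_contraction X d \<zeta> T \<longleftrightarrow>
     T \<in> X \<rightarrow> X \<and>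
     (\<forall>x\<in>X. \<forall>y\<in>X. \<zeta> (d (T x) (T y)) (Max {d x y, d x (T x), d y (T y)}) \<ge> 0)"

end

(* The simulation function forces a quantitative Meir-Keeler condition: for every e > 0 there is
   a \<delta> \<in> (0, e) such that M(x, y) < e + \<delta> implies d(Tx, Ty) \<le> e - \<delta>. Continuity of \<theta> and
   \<theta>(c, 0) \<le> c replace the triangle inequality: an error tending to 0 in one argument of \<theta>
   costs arbitrarily little. The step lengths of a Picard sequence decrease, and their limit is 0
   by the Meir-Keeler condition. Once the steps are small, the bound d(x_{m+1}, x_n) < e propagates
   from n to n+1, so the sequence is Cauchy. For its limit u, if e = d(u, Tu) > 0, then M(x_n, u) = e
   eventually, so d(x_{n+1}, Tu) \<le> e - \<delta>, and letting n tend to infinity gives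
   e \<le> \<theta>(0, e - \<delta>) \<le> e - \<delta>. *)
theory Submission
  imports Defs
begin

section \<open>Monotonicity of B-actions and their behaviour near 0\<close>

lemma B_action_mono:
  assumes "B_action \<theta>" "0 \<le> s" "0 \<le> t" "s \<le> u" "t \<le> v"
  shows "\<theta> s t \<le> \<theta> u v"
proof (cases "s = u \<and> t = v")
  case False
  then have "(s < u \<and> t \<le> v) \<or> (s \<le> u \<and> t < v)"
    using assms by auto
  moreover have "0 \<le> u" "0 \<le> v"
    using assms by auto
  ultimately show ?thesis
    using assms unfolding B_action_def by (meson less_imp_le)
qed simp

text \<open>By symmetry \<open>\<theta> 0 c = \<theta> c 0\<close>, and this is at most
  \<open>c\<close>, hence below \<open>e\<close>; continuity in the first argument keeps
  \<open>\<theta> t c\<close> below \<open>e\<close> for small \<open>t\<close>. This is how the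
  generalized triangle inequality absorbs a small first distance.\<close>

lemma B_action_near_0:
  assumes B: "B_action \<theta>" and c: "0 \<le> c" "c < e"
  obtains \<eta> where "\<eta> > 0" "\<And>t. 0 \<le> t \<Longrightarrow> t < \<eta> \<Longrightarrow> \<theta> t c < e"
proof -
  have cont: "continuous_on ({0..} \<times> {0..}) (\<lambda>(s, t). \<theta> s t)"
    and zero: "\<theta> 0 0 = 0"
    and sym: "\<forall>s\<ge>0. \<forall>t\<ge>0. \<theta> s t = \<theta> t s"
    and id: "\<forall>s>0. \<theta> s 0 \<le> s"
    using B unfolding B_action_def by - (elim conjE, assumption)+
  have "\<theta> 0 c = \<theta> c 0"
    using sym c(1) by blast
  also have "\<dots> \<le> c"
    using zero id c(1) by (cases "c = 0") auto
  finally have le: "\<theta> 0 c < e"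
    using c(2) by simp
  have "continuous_on {0..} (\<lambda>t. (\<lambda>(s, t). \<theta> s t) (t, c))"
    by (rule continuous_on_compose2[OF cont]) (use c in \<open>auto intro!: continuous_intros\<close>)
  then have "((\<lambda>t. \<theta> t c) \<longlongrightarrow> \<theta> 0 c) (at 0 within {0..})"
    by (simp add: continuous_on_def)
  then have "\<forall>\<^sub>F t in at 0 within {0..}. \<theta> t c < e"
    using le by (rule order_tendstoD)
  then obtain \<eta> where \<eta>: "\<eta> > 0" "\<And>t. t \<in> {0..} \<Longrightarrow> t \<noteq> 0 \<Longrightarrow> dist t 0 < \<eta> \<Longrightarrow> \<theta> t c < e"
    unfolding eventually_at by blast
  show thesis
  proof (rule that[OF \<eta>(1)])
    show "\<theta> t c < e" if "0 \<le> t" "t < \<eta>" for t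
      using le \<eta>(2)[of t] that by (cases "t = 0") auto
  qed
qed

section \<open>Simulation functions\<close>

lemma simulation_functionD:
  assumes "simulation_function \<zeta>" "t > 0" "s > 0" "\<zeta> t s \<ge> 0"
  shows "t < s"
proof -
  have "\<zeta> t s < s - t"
    using assms(1-3) unfolding simulation_function_def by blast
  then show ?thesis
    using assms(4) by simp
qed

text \<open>If every \<delta> fails, there are counterexamples \<open>t n\<close>,
  \<open>s n\<close> for margins tending to 0. Since \<open>t n < s n\<close>, the one-sided bounds
  \<open>t n > e - \<delta> n\<close> and \<open>s n < e + \<delta> n\<close> squeeze both sequences
  to \<open>e\<close>. The limit superior of \<zeta> along them is then negative, although all its
  values there are nonnegative.\<close>

lemma simulation_function_Meir_Keeler:
  fixes e :: real
  assumes sim: "simulation_function \<zeta>" and e: "e > 0"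
  obtains \<delta> where "0 < \<delta>" "\<delta> < e"
    "\<And>t s. t > 0 \<Longrightarrow> s > 0 \<Longrightarrow> \<zeta> t s \<ge> 0 \<Longrightarrow> s < e + \<delta> \<Longrightarrow> t \<le> e - \<delta>"
proof (rule ccontr)
  assume neg: "\<not> thesis"
  \<comment> \<open>The shift by 2 gives \<open>\<delta> n < e\<close> already at
    \<open>n = 0\<close>.\<close>
  define \<delta> where "\<delta> = (\<lambda>n. e / real (n + 2))"
  have "\<exists>t s. t > 0 \<and> s > 0 \<and> \<zeta> t s \<ge> 0 \<and> s < e + \<delta> n \<and> t > e - \<delta> n" for n
  proof (rule ccontr)
    assume *: "\<not> ?thesis"
    have "0 < \<delta> n" "\<delta> n < e"
      using e by (auto simp: \<delta>_def field_simps intro!: add_pos_nonneg)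
    with * show False
      using neg that[of "\<delta> n"] by (meson not_le)
  qed
  then obtain t s where ts: "\<And>n. t n > 0" "\<And>n. s n > 0" "\<And>n. \<zeta> (t n) (s n) \<ge> 0"
      "\<And>n. s n < e + \<delta> n" "\<And>n. t n > e - \<delta> n"
    by metis
  have lt: "t n < s n" for n
    using simulation_functionD[OF sim ts(1-3)] .
  have "\<delta> \<longlonglongrightarrow> 0"
    unfolding \<delta>_def
    by (rule LIMSEQ_ignore_initial_segment[OF lim_const_over_n])
  then have lim: "(\<lambda>n. e - \<delta> n) \<longlonglongrightarrow> e" "(\<lambda>n. e + \<delta> n) \<longlonglongrightarrow> e"
    using tendsto_diff[OF tendsto_const[of e], of \<delta> 0] tendsto_add[OF tendsto_const[of e], of \<delta> 0]
    by auto
  have bounds: "e - \<delta> n \<le> t n" "e - \<delta> n \<le> s n" "t n \<le> e + \<delta> n" "s n \<le> e + \<delta> n" for n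
    using ts(4,5)[of n] lt[of n] by auto
  have "t \<longlonglongrightarrow> e" "s \<longlonglongrightarrow> e"
    by (rule tendsto_sandwich[OF _ _ lim]; simp add: bounds)+
  then have "limsup (\<lambda>n. ereal (\<zeta> (t n) (s n))) < 0"
    using sim ts(1,2) e unfolding simulation_function_def by blast
  moreover have "0 \<le> limsup (\<lambda>n. ereal (\<zeta> (t n) (s n)))"
    by (rule le_Limsup) (use ts(3) in auto)
  ultimately show False
    by simp
qed

section \<open>Contraction estimates for \<open>T\<close>\<close>

locale theta_Z_contraction =
  fixes X :: "'a set"
    and \<theta> :: "real \<Rightarrow> real \<Rightarrow> real"
    and d :: "'a \<Rightarrow> 'a \<Rightarrow> real"
    and \<zeta> :: "real \<Rightarrow> real \<Rightarrow> real"
    and T :: "'a \<Rightarrow> 'a"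
  assumes theta_metric: "theta_metric_space X \<theta> d"
    and simulation: "simulation_function \<zeta>"
    and contraction: "modified_Z_contraction X d \<zeta> T"
begin

lemma B_action: "B_action \<theta>"
  and d_nonneg: "x \<in> X \<Longrightarrow> y \<in> X \<Longrightarrow> 0 \<le> d x y"
  and d_eq_0_iff: "x \<in> X \<Longrightarrow> y \<in> X \<Longrightarrow> d x y = 0 \<longleftrightarrow> x = y"
  and d_commute: "x \<in> X \<Longrightarrow> y \<in> X \<Longrightarrow> d x y = d y x"
  and d_theta: "x \<in> X \<Longrightarrow> y \<in> X \<Longrightarrow> z \<in> X \<Longrightarrow> d x y \<le> \<theta> (d x z) (d z y)"
  using theta_metric unfolding theta_metric_space_def by auto

lemma T_in: "x \<in> X \<Longrightarrow> T x \<in> X"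
  using contraction unfolding modified_Z_contraction_def by auto

lemma Picard_in: "x \<in> X \<Longrightarrow> (T ^^ n) x \<in> X"
  by (induction n) (auto simp: T_in)

lemma zeta_nonneg:
  "x \<in> X \<Longrightarrow> y \<in> X \<Longrightarrow> 0 \<le> \<zeta> (d (T x) (T y)) (Max {d x y, d x (T x), d y (T y)})"
  using contraction unfolding modified_Z_contraction_def by blast

lemma Max_pos:
  assumes "x \<in> X" "y \<in> X" "T x \<noteq> T y"
  shows "0 < Max {d x y, d x (T x), d y (T y)}"
proof -
  have "0 < d x y"
    using assms d_nonneg[of x y] d_eq_0_iff[of x y] by force
  then show ?thesis
    by (simp add: less_max_iff_disj)
qed

text \<open>Distinct images make both arguments of \<zeta> positive, which is the range where
  \<zeta>(t, s) < s - t is available.\<close>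

lemma dist_image_less_Max:
  assumes "x \<in> X" "y \<in> X" "T x \<noteq> T y"
  shows "d (T x) (T y) < Max {d x y, d x (T x), d y (T y)}"
proof -
  have "0 < d (T x) (T y)"
    using assms T_in d_nonneg[of "T x" "T y"] d_eq_0_iff[of "T x" "T y"] by force
  from simulation_functionD[OF simulation this Max_pos[OF assms] zeta_nonneg[OF assms(1,2)]]
  show ?thesis .
qed

lemma Meir_Keeler:
  assumes "e > 0"
  obtains \<delta> where "0 < \<delta>" "\<delta> < e"
    "\<And>x y. x \<in> X \<Longrightarrow> y \<in> X \<Longrightarrow> d x y < e + \<delta> \<Longrightarrow> d x (T x) < e + \<delta> \<Longrightarrow> d y (T y) < e + \<delta>
      \<Longrightarrow> d (T x) (T y) \<le> e - \<delta>"
proof -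
  obtain \<delta> where \<delta>: "0 < \<delta>" "\<delta> < e"
    "\<And>t s. t > 0 \<Longrightarrow> s > 0 \<Longrightarrow> \<zeta> t s \<ge> 0 \<Longrightarrow> s < e + \<delta> \<Longrightarrow> t \<le> e - \<delta>"
    using simulation_function_Meir_Keeler[OF simulation assms] by blast
  show thesis
  proof (rule that[OF \<delta>(1,2)])
    fix x y
    assume x: "x \<in> X" "y \<in> X"
      and M: "d x y < e + \<delta>" "d x (T x) < e + \<delta>" "d y (T y) < e + \<delta>"
    show "d (T x) (T y) \<le> e - \<delta>"
    proof (cases "T x = T y")
      \<comment> \<open>Here \<zeta> gives no information, but the distance is 0 and
        \<open>\<delta> < e\<close> makes the bound nonnegative.\<close>
      case True
      then show ?thesis
        using x T_in d_eq_0_iff[of "T x" "T y"] \<delta>(2) by auto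
    next
      case False
      then have "0 < d (T x) (T y)"
        using x T_in d_nonneg[of "T x" "T y"] d_eq_0_iff[of "T x" "T y"] by force
      then show ?thesis
        by (rule \<delta>(3)[OF _ Max_pos[OF x False] zeta_nonneg[OF x]]) (use M in simp)
    qed
  qed
qed

text \<open>At two fixed points the self-displacements vanish, so the maximum is
  \<open>d u v\<close> itself and strict contraction would give
  \<open>d u v < d u v\<close>.\<close>

lemma fixed_point_unique:
  assumes "u \<in> X" "v \<in> X" "T u = u" "T v = v"
  shows "u = v"
proof (rule ccontr)
  assume "u \<noteq> v"
  then have "d u v < Max {d u v, d u u, d v v}"
    using dist_image_less_Max[of u v] assms by simp
  moreover have "d u u = 0" "d v v = 0"
    using assms d_eq_0_iff by auto
  ultimately show False
    using d_nonneg[of u v] assms by simp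
qed

section \<open>Picard sequences\<close>

lemma Picard_steps_tendsto_0:
  assumes x: "x \<in> X"
  shows "(\<lambda>n. d ((T ^^ n) x) ((T ^^ Suc n) x)) \<longlonglongrightarrow> 0"
proof -
  define a where "a = (\<lambda>n. d ((T ^^ n) x) ((T ^^ Suc n) x))"
  have a_nonneg: "0 \<le> a n" for n
    unfolding a_def using x Picard_in d_nonneg by blast
  have step: "a (Suc n) \<le> a n" for n
  proof (cases "(T ^^ Suc n) x = (T ^^ Suc (Suc n)) x")
    case True
    then have "a (Suc n) = 0"
      unfolding a_def using x Picard_in d_eq_0_iff by blast
    then show ?thesis
      using a_nonneg by simp
  next
    \<comment> \<open>The maximum is that of \<open>a n\<close> and \<open>a (Suc n)\<close>; as
      \<open>a (Suc n)\<close> is strictly below it, the maximum must be \<open>a n\<close>.\<close>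
    case False
    then show ?thesis
      using dist_image_less_Max[of "(T ^^ n) x" "(T ^^ Suc n) x"] Picard_in[OF x, of n]
        Picard_in[OF x, of "Suc n"]
      by (auto simp: a_def)
  qed
  then have dec: "decseq a"
    by (simp add: decseq_Suc_iff)
  obtain r where r: "a \<longlonglongrightarrow> r" "\<And>n. r \<le> a n"
    using decseq_convergent[OF dec] a_nonneg by blast
  have "r \<ge> 0"
    using r(1) a_nonneg by (intro LIMSEQ_le_const) auto
  moreover have "\<not> r > 0"
  proof
    assume "r > 0"
    then obtain \<delta> where \<delta>: "0 < \<delta>"
      "\<And>x y. x \<in> X \<Longrightarrow> y \<in> X \<Longrightarrow> d x y < r + \<delta> \<Longrightarrow> d x (T x) < r + \<delta> \<Longrightarrow> d y (T y) < r + \<delta>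
        \<Longrightarrow> d (T x) (T y) \<le> r - \<delta>"
      using Meir_Keeler by metis
    have "\<forall>\<^sub>F n in sequentially. a n < r + \<delta>"
      using r(1) \<delta>(1) by (intro order_tendstoD) auto
    then obtain n where n: "a n < r + \<delta>"
      by (auto simp: eventually_sequentially)
    then have "a (Suc n) < r + \<delta>"
      using step[of n] by linarith
    \<comment> \<open>For consecutive iterates the three terms of the maximum are
      \<open>a n\<close>, \<open>a n\<close> and \<open>a (Suc n)\<close>. The resulting bound drops
      below the limit \<open>r\<close>, yet the decreasing sequence stays above it.\<close>
    with n have "a (Suc n) \<le> r - \<delta>"
      using \<delta>(2)[of "(T ^^ n) x" "(T ^^ Suc n) x"] Picard_in[OF x, of n]
        Picard_in[OF x, of "Suc n"] by (simp add: a_def)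
    then show False
      using r(2)[of "Suc n"] \<delta>(1) by simp
  qed
  ultimately show ?thesis
    using r(1) by (simp add: a_def)
qed

lemma Picard_Cauchy:
  assumes x: "x \<in> X"
  shows "theta_Cauchy d (\<lambda>n. (T ^^ n) x)"
  unfolding theta_Cauchy_def
proof (intro allI impI)
  fix e :: real
  assume e: "e > 0"
  let ?x = "\<lambda>n. (T ^^ n) x"
  note inX = Picard_in[OF x]
  obtain \<delta> where \<delta>: "0 < \<delta>"
    "\<And>x y. x \<in> X \<Longrightarrow> y \<in> X \<Longrightarrow> d x y < e + \<delta> \<Longrightarrow> d x (T x) < e + \<delta> \<Longrightarrow> d y (T y) < e + \<delta>
      \<Longrightarrow> d (T x) (T y) \<le> e - \<delta>"
    using Meir_Keeler[OF e] by metis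
  obtain \<eta> where \<eta>: "\<eta> > 0" "\<And>t. 0 \<le> t \<Longrightarrow> t < \<eta> \<Longrightarrow> \<theta> t e < e + \<delta>"
    using B_action_near_0[OF B_action, of e "e + \<delta>"] e \<delta>(1) by auto
  \<comment> \<open>Below \<open>\<eta>\<close>, a step raises a distance bound \<open>e\<close> to
    less than \<open>e + \<delta>\<close> under \<theta>; below \<open>e\<close>, it also keeps the
    displacement terms of the maximum under \<open>e + \<delta>\<close>.\<close>
  have "\<forall>\<^sub>F n in sequentially. d (?x n) (?x (Suc n)) < min \<eta> e"
    using Picard_steps_tendsto_0[OF x] \<eta>(1) e by (intro order_tendstoD) auto
  then obtain N where N: "\<And>n. n \<ge> N \<Longrightarrow> d (?x n) (?x (Suc n)) < min \<eta> e"
    by (auto simp: eventually_sequentially)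
  \<comment> \<open>Going back from index \<open>Suc m\<close> to \<open>m\<close> enlarges the
    bound \<open>e\<close> to less than \<open>e + \<delta>\<close>. Applying \<open>T\<close> to
    the pair with indices \<open>m\<close> and \<open>n\<close> then advances both indices and
    brings the distance down to at most \<open>e - \<delta>\<close>, which closes the induction on
    \<open>n\<close>.\<close>
  have close: "d (?x (Suc m)) (?x n) < e" if m: "m \<ge> N" and "n \<ge> Suc m" for m n
    using \<open>n \<ge> Suc m\<close>
  proof (induction n rule: dec_induct)
    case base
    show ?case
      using e d_eq_0_iff[OF inX inX, of "Suc m" "Suc m"] by simp
  next
    case (step n)
    have "d (?x m) (?x n) \<le> \<theta> (d (?x m) (?x (Suc m))) (d (?x (Suc m)) (?x n))"
      by (intro d_theta inX)
    also have "\<dots> \<le> \<theta> (d (?x m) (?x (Suc m))) e"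
      using step.IH by (intro B_action_mono[OF B_action] d_nonneg inX) auto
    also have "\<dots> < e + \<delta>"
      using N[OF m] by (intro \<eta>(2) d_nonneg inX) auto
    finally have "d (T (?x m)) (T (?x n)) \<le> e - \<delta>"
      using N[OF m] N[of n] m step.hyps \<delta>(1) by (intro \<delta>(2) inX) auto
    then show ?case
      using \<delta>(1) by simp
  qed
  \<comment> \<open>The threshold is \<open>Suc N\<close> because \<open>close\<close> writes its
    smaller index as a successor.\<close>
  have "d (?x n) (?x m) < e" if "n \<ge> Suc N" "m \<ge> Suc N" for n m
  proof (cases "n \<le> m")
    case True
    then show ?thesis
      using close[of "n - 1" m] that by (cases n) auto
  next
    case False
    then show ?thesis
      using close[of "m - 1" n] that d_commute[OF inX inX, of n m] by (cases m) auto
  qed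
  then show "\<exists>N. \<forall>n\<ge>N. \<forall>m\<ge>N. d (?x n) (?x m) < e"
    by blast
qed

lemma Picard_limit_fixed:
  assumes x: "x \<in> X" and u: "u \<in> X" and lim: "theta_converges d (\<lambda>n. (T ^^ n) x) u"
  shows "T u = u"
proof (rule ccontr)
  let ?x = "\<lambda>n. (T ^^ n) x"
  note inX = Picard_in[OF x]
  note Tu = T_in[OF u]
  assume "T u \<noteq> u"
  define e where "e = d u (T u)"
  have e: "e > 0"
    unfolding e_def
    using \<open>T u \<noteq> u\<close> d_nonneg[OF u Tu] d_eq_0_iff[OF u Tu] by force
  obtain \<delta> where \<delta>: "0 < \<delta>" "\<delta> < e"
    "\<And>x y. x \<in> X \<Longrightarrow> y \<in> X \<Longrightarrow> d x y < e + \<delta> \<Longrightarrow> d x (T x) < e + \<delta> \<Longrightarrow> d y (T y) < e + \<delta>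
      \<Longrightarrow> d (T x) (T y) \<le> e - \<delta>"
    using Meir_Keeler[OF e] by metis
  \<comment> \<open>This \<eta> replaces a passage to the limit: one sufficiently late iterate
    yields the contradiction. The value \<open>e - \<delta>\<close> is a legitimate argument of
    \<theta> since \<open>\<delta> < e\<close>.\<close>
  obtain \<eta> where \<eta>: "\<eta> > 0" "\<And>t. 0 \<le> t \<Longrightarrow> t < \<eta> \<Longrightarrow> \<theta> t (e - \<delta>) < e"
    using B_action_near_0[OF B_action, of "e - \<delta>" e] \<delta> by auto
  have "(\<lambda>n. d (?x n) u) \<longlonglongrightarrow> 0"
    using lim by (simp add: theta_converges_def)
  then have "\<forall>\<^sub>F n in sequentially. d (?x n) u < min \<eta> e"
    using \<eta>(1) e by (intro order_tendstoD) auto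
  then obtain N1 where N1: "\<And>n. n \<ge> N1 \<Longrightarrow> d (?x n) u < min \<eta> e"
    by (auto simp: eventually_sequentially)
  have "\<forall>\<^sub>F n in sequentially. d (?x n) (?x (Suc n)) < e"
    using Picard_steps_tendsto_0[OF x] e by (intro order_tendstoD) auto
  then obtain N2 where N2: "\<And>n. n \<ge> N2 \<Longrightarrow> d (?x n) (?x (Suc n)) < e"
    by (auto simp: eventually_sequentially)
  define n where "n = max N1 N2"
  \<comment> \<open>The displacement of \<open>u\<close> equals \<open>e\<close> exactly, so the
    slack \<open>\<delta>\<close> above \<open>e\<close> is what admits it; the other two terms are
    below \<open>e\<close>.\<close>
  have "d (T (?x n)) (T u) \<le> e - \<delta>"
    using N1[of n] N2[of n] \<delta>(1) by (intro \<delta>(3) inX u) (auto simp: n_def e_def)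
  then have le: "d (?x (Suc n)) (T u) \<le> e - \<delta>"
    by simp
  have "e \<le> \<theta> (d u (?x (Suc n))) (d (?x (Suc n)) (T u))"
    unfolding e_def by (intro d_theta u Tu inX)
  also have "\<dots> \<le> \<theta> (d u (?x (Suc n))) (e - \<delta>)"
    using le by (intro B_action_mono[OF B_action] d_nonneg inX u Tu) auto
  also have "\<dots> < e"
    using N1[of "Suc n"] d_commute[OF u inX, of "Suc n"]
    by (intro \<eta>(2) d_nonneg u inX) (auto simp: n_def)
  finally show False
    by simp
qed

end

theorem theorem3p9:
  fixes X :: "'a set"
    and \<theta> :: "real \<Rightarrow> real \<Rightarrow> real"
    and d :: "'a \<Rightarrow> 'a \<Rightarrow> real"
    and \<zeta> :: "real \<Rightarrow> real \<Rightarrow> real"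
    and T :: "'a \<Rightarrow> 'a"
  assumes "complete_theta_metric_space X \<theta> d"
    and "simulation_function \<zeta>"
    and "modified_Z_contraction X d \<zeta> T"
  shows "\<exists>u\<in>X. T u = u \<and> (\<forall>v\<in>X. T v = v \<longrightarrow> v = u) \<and>
           (\<forall>x0\<in>X. theta_converges d (\<lambda>n. (T ^^ n) x0) u)"
proof -
  have metric: "theta_metric_space X \<theta> d"
    using assms(1) by (simp add: complete_theta_metric_space_def)
  interpret theta_Z_contraction X \<theta> d \<zeta> T
    using metric assms(2,3) by unfold_locales
  have lim: "\<exists>a\<in>X. T a = a \<and> theta_converges d (\<lambda>n. (T ^^ n) x) a" if "x \<in> X" for x
  proof -
    have "(\<forall>n. (T ^^ n) x \<in> X) \<and> theta_Cauchy d (\<lambda>n. (T ^^ n) x)"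
      using Picard_in[OF that] Picard_Cauchy[OF that] by blast
    then have "\<exists>a\<in>X. theta_converges d (\<lambda>n. (T ^^ n) x) a"
      using assms(1) unfolding complete_theta_metric_space_def by metis
    then show ?thesis
      using Picard_limit_fixed[OF that] by blast
  qed
  \<comment> \<open>Some starting point supplies \<open>u\<close>; every other Picard limit is also
    a fixed point, so uniqueness identifies it with \<open>u\<close>.\<close>
  obtain x where "x \<in> X"
    using metric by (auto simp: theta_metric_space_def)
  then obtain u where u: "u \<in> X" "T u = u"
    using lim by blast
  show ?thesis
  proof (intro bexI[of _ u] conjI ballI impI u)
    show "v = u" if "v \<in> X" "T v = v" for v
      using fixed_point_unique that u by blast
    show "theta_converges d (\<lambda>n. (T ^^ n) x0) u" if "x0 \<in> X" for x0
      using lim[OF that] fixed_point_unique u by blast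
  qed
qed

end
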